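(* Let $M\in\mathbb N$, let $\mathcal H$ be a separable Hilbert space, $p\in[1,\infty]$, and let $u\in C(\boldsymbol\Gamma;\mathcal H)$, $\boldsymbol\Gamma=[-1,1]^M$, admit a polynomial expansion $$u(\mathbf y)=\sum_{\mathbf k\in\mathcal F}u_{\mathbf k}P_{\mathbf k}(\mathbf y),\qquad u_{\mathbf k}\in\mathcal H,\quad P_{\mathbf k}(\mathbf y)=\prod_{m=1}^MP_{k_m}(y_m),$$ converging in $L^p_\mu(\boldsymbol\Gamma;\mathcal H)$, where the $P_k:\Gamma\to\mathbb R$ are univariate polynomials of degree $k$ with $P_0\equiv1$ satisfying, for finite constants $\widetilde c,\widetilde\theta\ge0$, $$\|P_k\|_{C(\Gamma;\mathbb R)}\le(1+\widetilde ck)^{\widetilde\theta}\qquad\forall k\in\mathbb N_0.$$ Assume further that 1. $(\boldsymbol\rho^{\mathbf k}\|u_{\mathbf k}\|_{\mathcal H})_{\mathbf k\in\mathcal F}\in\ell^2(\mathcal F)$ for some $\boldsymbol\rho\in\mathbb R^M$ with $\rho_m>1$ for all $m=1,\dots,M$; 2. there is a constant $C<\infty$ such that for every finite monotone $\Lambda\subset\mathcal F$ $$\|u-S_\Lambda u\|_{L^p_\mu(\boldsymbol\Gamma;\mathcal H)}\le C\sum_{\mathbf k\in\mathrm R(\Lambda)}\|\Delta_{\mathbf k}u\|_{L^p_\mu(\boldsymbol\Gamma;\mathcal H)};$$ 3. there are finite constants $0\le c,\theta<\infty$ such that the univariate detail operators satisfy $\|\Delta_k\|_\infty\le(1+ck)^\theta$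 for all $k\in\mathbb N_0$. Then any sequence of approximations $(u_n)_{n\in\mathbb N_0}$ generated by the Gerstner–Griebel algorithm described in the context (run with this $p$) satisfies $$\lim_{n\to\infty}\|u-u_n\|_{L^p_\mu(\boldsymbol\Gamma;\mathcal H)}=0.$$
   Context: **Parameter domain.** $\Gamma=[-1,1]$, $\boldsymbol\Gamma=\Gamma^M$, $\mu=\bigotimes_{m=1}^M\frac{dy_m}{2}$ is the uniform probability measure on $\boldsymbol\Gamma$, $\mathcal F=\mathbb N_0^M$, $\mathbf e_m$ is the $m$th unit multi-index, $\boldsymbol\rho^{\mathbf k}=\prod_m\rho_m^{k_m}$; $L^p_\mu(\boldsymbol\Gamma;\mathcal H)$ is the Bochner space. **Nodes.** $(y_{(i)})_{i\in\mathbb N_0}\subset[-1,1]$ is a sequence of distinct nodes, $\mathfrak m:\mathbb N_0\to\mathbb N_0$ is a strictly increasing function with $\mathfrak m(0)=0$, and $\mathcal Y_k=\{y_{(i)}: i=0,\dots,\mathfrak m(k)\}$ (nested sets). **Detail operators.** $\mathcal I_k$ maps a continuous function on $\Gamma$ (real or Hilbert-space valued) to its unique Lagrange interpolant of degree at most $\mathfrak m(k)$ on $\mathcal Y_k$. $\Delta_0=\mathcal I_0$, $\Delta_k=\mathcal I_k-\mathcal I_{k-1}$ for $k\ge1$, and $\|\Delta_k\|_\infty=\sup_{0\ne g\in C(\Gamma;\mathbb R)}\|\Delta_kg\|_{C(\Gamma;\mathbb R)}/\|g\|_{C(\Gamma;\mathbb R)}$. For $\mathbf i\in\mathcal F$,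 $\Delta_{\mathbf i}=\bigotimes_{m=1}^M\Delta_{i_m}$ ($\Delta_{i_m}$ acting in the variable $y_m$). For finite $\Lambda\subset\mathcal F$, $S_\Lambda=\sum_{\mathbf i\in\Lambda}\Delta_{\mathbf i}$. **Index sets.** $\Lambda\subset\mathcal F$ is monotone (downward closed) if $\mathbf i\in\Lambda$ and $i_m\ge1$ imply $\mathbf i-\mathbf e_m\in\Lambda$. The reduced margin $\mathrm R(\Lambda)$ is the set of $\mathbf k\in\mathcal F\setminus\Lambda$ such that $\mathbf k-\mathbf e_m\in\Lambda$ for at least one $m$ and $\mathbf k-\mathbf e_m\in\Lambda$ for all $m\in\{1,\dots,M\}$ with $k_m\ge1$. **Gerstner–Griebel algorithm.** $\Lambda_0=\{\mathbf 0\}$, $u_0=S_{\Lambda_0}u$. For $n=0,1,2,\dots$: compute $\eta_n(\mathbf k)=\|\Delta_{\mathbf k}u\|_{L^p_\mu(\boldsymbol\Gamma;\mathcal H)}$ for $\mathbf k\in\mathrm R(\Lambda_n)$; choose $\mathbf k_n^*\in\arg\max_{\mathbf k\in\mathrm R(\Lambda_n)}\eta_n(\mathbf k)$ (any maximizer); set $\Lambda_{n+1}=\Lambda_n\cup\{\mathbf k_n^*\}$ and $u_{n+1}=S_{\Lambda_{n+1}}u$. *)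

theory Defs
  imports "HOL-Probability.Probability" "HOL-Computational_Algebra.Polynomial"
begin

section \<open>Parameter domain and Bochner norms\<close>

text \<open>
  The dimension \<open>M\<close> is the cardinality of a finite index type \<open>'m\<close>; parameter points are
  functions \<open>'m \<Rightarrow> real\<close> and multi-indices are functions \<open>'m \<Rightarrow> nat\<close>.
\<close>

definition param_domain :: "('m::finite \<Rightarrow> real) set" where
  "param_domain = {y. \<forall>m. y m \<in> {-1..1}}"

text \<open>
  The factors live on the space \<open>{-1..1}\<close> (not on the whole line), so that measurability of a
  function only depends on its values on the parameter domain.
\<close>

definition param_measure :: "('m::finite \<Rightarrow> real) measure" where
  "param_measure = PiM UNIV (\<lambda>_. uniform_measure (restrict_space lborel {-1..1}) {-1..1})"

lemma space_param_measure: "space param_measure = param_domain"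
  by (auto simp: param_measure_def param_domain_def space_PiM space_restrict_space PiE_UNIV_domain)

lemma prob_space_param_measure: "prob_space (param_measure :: ('m::finite \<Rightarrow> real) measure)"
proof -
  have "prob_space (uniform_measure (restrict_space lborel {-1..1}) {-1..1::real})"
    by (rule prob_space_uniform_measure) (auto simp: emeasure_restrict_space)
  then show ?thesis
    unfolding param_measure_def by (intro prob_space_PiM)
qed

text \<open>
  The norm takes extended values; it is infinite for functions outside the Bochner space
  \<open>L\<^sup>p(M; 'h)\<close>.  For a separable \<open>'h\<close>, strong measurability is Borel measurability.
\<close>

definition Lp_norm ::
  "ennreal \<Rightarrow> 'a measure \<Rightarrow> ('a \<Rightarrow> 'h::{banach, second_countable_topology}) \<Rightarrow> ennreal" where
  "Lp_norm p M f =
     (if f \<notin> borel_measurable M then \<infinity>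
      else if p = \<infinity> then esssup M (\<lambda>x. ennreal (norm (f x)))
      else (let I = (\<integral>\<^sup>+ x. ennreal (norm (f x) powr enn2real p) \<partial>M)
            in if I = \<infinity> then \<infinity> else ennreal (enn2real I powr (1 / enn2real p))))"

section \<open>Univariate interpolation and detail operators\<close>

definition sup_norm :: "(real \<Rightarrow> real) \<Rightarrow> real" where
  "sup_norm g = (SUP t\<in>{-1..1}. \<bar>g t\<bar>)"

definition vpolys :: "nat \<Rightarrow> (real \<Rightarrow> 'b::real_vector) set" where
  "vpolys n = {q. \<exists>a. q = (\<lambda>t. \<Sum>j\<le>n. t ^ j *\<^sub>R a j)}"

text \<open>
  \<open>node\<close> is the node sequence, and \<open>mm k\<close> is the index of the last node (and the degree bound)
  at level \<open>k\<close>.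
\<close>

definition interp ::
  "(nat \<Rightarrow> real) \<Rightarrow> (nat \<Rightarrow> nat) \<Rightarrow> nat \<Rightarrow> (real \<Rightarrow> 'b::real_vector) \<Rightarrow> real \<Rightarrow> 'b" where
  "interp node mm k g = (THE q. q \<in> vpolys (mm k) \<and> (\<forall>t\<in>node ` {0..mm k}. q t = g t))"

definition detail ::
  "(nat \<Rightarrow> real) \<Rightarrow> (nat \<Rightarrow> nat) \<Rightarrow> nat \<Rightarrow> (real \<Rightarrow> 'b::real_vector) \<Rightarrow> real \<Rightarrow> 'b" where
  "detail node mm k g =
     (if k = 0 then interp node mm 0 g
      else (\<lambda>t. interp node mm k g t - interp node mm (k - 1) g t))"

definition detail_opnorm :: "(nat \<Rightarrow> real) \<Rightarrow> (nat \<Rightarrow> nat) \<Rightarrow> nat \<Rightarrow> ennreal" where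
  "detail_opnorm node mm k =
     (SUP g\<in>{g :: real \<Rightarrow> real. continuous_on {-1..1} g \<and> (\<exists>t\<in>{-1..1}. g t \<noteq> 0)}.
        ennreal (sup_norm (detail node mm k g) / sup_norm g))"

section \<open>Tensorized detail operators\<close>

text \<open>\<open>detail_in node mm m k\<close> is the univariate detail operator acting in the variable \<open>y m\<close>.\<close>

definition detail_in ::
  "(nat \<Rightarrow> real) \<Rightarrow> (nat \<Rightarrow> nat) \<Rightarrow> 'm \<Rightarrow> nat \<Rightarrow> (('m \<Rightarrow> real) \<Rightarrow> 'h::real_vector)
     \<Rightarrow> ('m \<Rightarrow> real) \<Rightarrow> 'h" where
  "detail_in node mm m k f = (\<lambda>y. detail node mm k (\<lambda>t. f (y(m := t))) (y m))"

text \<open>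
  The tensor product is the composition of the coordinatewise operators over all coordinates.
  These operators commute for distinct nodes (lemma \<open>comp_fun_commute_detail_in\<close> below), so
  the fold does not depend on the order.
\<close>

definition tensor_detail ::
  "(nat \<Rightarrow> real) \<Rightarrow> (nat \<Rightarrow> nat) \<Rightarrow> ('m::finite \<Rightarrow> nat) \<Rightarrow> (('m \<Rightarrow> real) \<Rightarrow> 'h::real_vector)
     \<Rightarrow> ('m \<Rightarrow> real) \<Rightarrow> 'h" where
  "tensor_detail node mm i u = Finite_Set.fold (\<lambda>m f. detail_in node mm m (i m) f) u UNIV"

definition sparse_interp ::
  "(nat \<Rightarrow> real) \<Rightarrow> (nat \<Rightarrow> nat) \<Rightarrow> ('m::finite \<Rightarrow> nat) set \<Rightarrow> (('m \<Rightarrow> real) \<Rightarrow> 'h::real_vector)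
     \<Rightarrow> ('m \<Rightarrow> real) \<Rightarrow> 'h" where
  "sparse_interp node mm \<Lambda> u = (\<lambda>y. \<Sum>i\<in>\<Lambda>. tensor_detail node mm i u y)"

subsection \<open>Well-definedness\<close>

definition lagrange_basis :: "(nat \<Rightarrow> real) \<Rightarrow> nat \<Rightarrow> nat \<Rightarrow> real poly" where
  "lagrange_basis node n i =
     (\<Prod>j\<in>{..n} - {i}. smult (1 / (node i - node j)) [:- node j, 1:])"

lemma degree_lagrange_basis:
  assumes "i \<le> n"
  shows "degree (lagrange_basis node n i) \<le> n"
proof -
  have "degree (lagrange_basis node n i) \<le>
      (\<Sum>j\<in>{..n} - {i}. degree (smult (1 / (node i - node j)) [:- node j, 1:]))"
    unfolding lagrange_basis_def
    using degree_prod_sum_le[of "{..n} - {i}" "\<lambda>j. smult (1 / (node i - node j)) [:- node j, 1:]"]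
    by (simp add: comp_def)
  also have "\<dots> \<le> (\<Sum>j\<in>{..n} - {i}. 1)"
    by (rule sum_mono) (simp add: degree_smult_le)
  also have "\<dots> = n" using assms by simp
  finally show ?thesis .
qed

lemma poly_lagrange_basis:
  assumes "inj node" "i \<le> n" "l \<le> n"
  shows "poly (lagrange_basis node n i) (node l) = (if l = i then 1 else 0)"
proof (cases "l = i")
  case True
  then show ?thesis
    using assms(1) by (auto simp: lagrange_basis_def poly_prod divide_simps inj_eq intro!: prod.neutral)
next
  case False
  then show ?thesis
    using assms by (auto simp: lagrange_basis_def poly_prod intro!: prod_zero bexI[of _ l])
qed

lemma real_poly_lagrange:
  assumes "inj node" "degree q \<le> n"
  shows "q = (\<Sum>i\<le>n. smult (poly q (node i)) (lagrange_basis node n i))" (is "_ = ?r")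
proof (rule poly_eqI_degree[where A = "node ` {..n}"])
  have c: "card (node ` {..n}) = Suc n"
    using assms(1) by (subst card_image) (auto intro: inj_on_subset)
  show "degree q < card (node ` {..n})" using assms(2) c by simp
  have "degree ?r \<le> n"
    by (intro degree_sum_le) (auto intro!: order.trans[OF degree_smult_le] degree_lagrange_basis)
  then show "degree ?r < card (node ` {..n})" using c by simp
next
  fix x assume "x \<in> node ` {..n}"
  then obtain l where l: "l \<le> n" "x = node l" by auto
  have "poly ?r x = (\<Sum>i\<le>n. poly q (node i) * (if l = i then 1 else 0))"
    unfolding poly_sum using assms(1) l by (intro sum.cong) (auto simp: poly_lagrange_basis)
  also have "\<dots> = (\<Sum>i\<le>n. if l = i then poly q (node i) else 0)"
    by (intro sum.cong) auto
  also have "\<dots> = poly q x" using l by simp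
  finally show "poly q x = poly ?r x" ..
qed

lemma vpolys_lagrange:
  fixes q :: "real \<Rightarrow> 'b::real_vector"
  assumes "inj node" "q \<in> vpolys n"
  shows "q t = (\<Sum>i\<le>n. poly (lagrange_basis node n i) t *\<^sub>R q (node i))"
proof -
  obtain a where a: "q = (\<lambda>t. \<Sum>j\<le>n. t ^ j *\<^sub>R a j)"
    using assms(2) by (auto simp: vpolys_def)
  have pw: "t ^ j = (\<Sum>i\<le>n. poly (lagrange_basis node n i) t * node i ^ j)" if "j \<le> n" for j
  proof -
    have "monom 1 j = (\<Sum>i\<le>n. smult (poly (monom 1 j) (node i)) (lagrange_basis node n i))"
      using assms(1) that by (intro real_poly_lagrange) (auto simp: degree_monom_eq)
    then have "poly (monom 1 j) t =
        poly (\<Sum>i\<le>n. smult (poly (monom 1 j) (node i)) (lagrange_basis node n i)) t"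
      by simp
    then show ?thesis by (simp add: poly_sum poly_monom mult.commute)
  qed
  have "q t = (\<Sum>j\<le>n. (\<Sum>i\<le>n. poly (lagrange_basis node n i) t * node i ^ j) *\<^sub>R a j)"
    unfolding a by (intro sum.cong) (auto simp flip: pw)
  also have "\<dots> = (\<Sum>i\<le>n. poly (lagrange_basis node n i) t *\<^sub>R (\<Sum>j\<le>n. node i ^ j *\<^sub>R a j))"
    by (simp add: scaleR_sum_left scaleR_sum_right) (rule sum.swap)
  finally show ?thesis unfolding a .
qed

lemma lagrange_in_vpolys:
  "(\<lambda>t. \<Sum>i\<le>n. poly (lagrange_basis node n i) t *\<^sub>R b i) \<in> vpolys n"
proof -
  have "(\<Sum>i\<le>n. poly (lagrange_basis node n i) t *\<^sub>R b i) =
      (\<Sum>j\<le>n. t ^ j *\<^sub>R (\<Sum>i\<le>n. coeff (lagrange_basis node n i) j *\<^sub>R b i))" for t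
  proof -
    have "(\<Sum>i\<le>n. poly (lagrange_basis node n i) t *\<^sub>R b i) =
        (\<Sum>i\<le>n. (\<Sum>j\<le>n. coeff (lagrange_basis node n i) j * t ^ j) *\<^sub>R b i)"
    proof (intro sum.cong refl)
      fix i assume "i \<in> {..n}"
      then have "degree (lagrange_basis node n i) \<le> n" by (simp add: degree_lagrange_basis)
      then have "poly (lagrange_basis node n i) t =
          (\<Sum>j\<le>n. coeff (lagrange_basis node n i) j * t ^ j)"
        unfolding poly_altdef by (intro sum.mono_neutral_left) (auto simp: coeff_eq_0)
      then show "poly (lagrange_basis node n i) t *\<^sub>R b i =
          (\<Sum>j\<le>n. coeff (lagrange_basis node n i) j * t ^ j) *\<^sub>R b i" by simp
    qed
    also have "\<dots> = (\<Sum>j\<le>n. t ^ j *\<^sub>R (\<Sum>i\<le>n. coeff (lagrange_basis node n i) j *\<^sub>R b i))"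
      by (simp add: scaleR_sum_left scaleR_sum_right mult.commute) (rule sum.swap)
    finally show ?thesis .
  qed
  then show ?thesis
    unfolding vpolys_def mem_Collect_eq
    by (intro exI[of _ "\<lambda>j. \<Sum>i\<le>n. coeff (lagrange_basis node n i) j *\<^sub>R b i"] ext)
qed

lemma lagrange_interpolates:
  fixes b :: "nat \<Rightarrow> 'b::real_vector"
  assumes "inj node" "l \<le> n"
  shows "(\<Sum>i\<le>n. poly (lagrange_basis node n i) (node l) *\<^sub>R b i) = b l"
proof -
  have "(\<Sum>i\<le>n. poly (lagrange_basis node n i) (node l) *\<^sub>R b i) =
      (\<Sum>i\<le>n. if l = i then b i else 0)"
    using assms by (intro sum.cong) (auto simp: poly_lagrange_basis)
  then show ?thesis using assms(2) by simp
qed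

lemma interpolant_unique:
  fixes q :: "real \<Rightarrow> 'b::real_vector"
  assumes "inj node" "q \<in> vpolys n" "\<forall>t\<in>node ` {0..n}. q t = g t"
  shows "q = (\<lambda>t. \<Sum>i\<le>n. poly (lagrange_basis node n i) t *\<^sub>R g (node i))"
proof
  fix t
  have "q t = (\<Sum>i\<le>n. poly (lagrange_basis node n i) t *\<^sub>R q (node i))"
    by (rule vpolys_lagrange[OF assms(1,2)])
  also have "\<dots> = (\<Sum>i\<le>n. poly (lagrange_basis node n i) t *\<^sub>R g (node i))"
    using assms(3) by (intro sum.cong) auto
  finally show "q t = (\<Sum>i\<le>n. poly (lagrange_basis node n i) t *\<^sub>R g (node i))" .
qed

lemma lagrange_is_interpolant:
  assumes "inj node"
  shows "(\<lambda>t. \<Sum>i\<le>n. poly (lagrange_basis node n i) t *\<^sub>R g (node i)) \<in> vpolys n \<and>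
    (\<forall>t\<in>node ` {0..n}. (\<Sum>i\<le>n. poly (lagrange_basis node n i) t *\<^sub>R g (node i)) = g t)"
  by (intro conjI ballI lagrange_in_vpolys)
    (auto simp: lagrange_interpolates[OF assms, where b = "\<lambda>i. g (node i)"])

lemma interp_ex1:
  fixes g :: "real \<Rightarrow> 'b::real_vector"
  assumes "inj node"
  shows "\<exists>!q. q \<in> vpolys (mm k) \<and> (\<forall>t\<in>node ` {0..mm k}. q t = g t)"
  by (rule ex1I, rule lagrange_is_interpolant[OF assms])
    (elim conjE, rule interpolant_unique[OF assms])

lemma interp_lagrange:
  fixes g :: "real \<Rightarrow> 'b::real_vector"
  assumes "inj node"
  shows "interp node mm k g = (\<lambda>t. \<Sum>i\<le>mm k. poly (lagrange_basis node (mm k) i) t *\<^sub>R g (node i))"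
  unfolding interp_def
  by (rule the1_equality[OF interp_ex1[OF assms]]) (rule lagrange_is_interpolant[OF assms])

lemma detail_eq_sum:
  assumes "inj node"
  obtains n w where
    "\<And>g :: real \<Rightarrow> 'b::real_vector. detail node mm k g = (\<lambda>t. \<Sum>i\<le>(n::nat). w i t *\<^sub>R g (node i))"
proof (cases "k = 0")
  case True
  then show ?thesis
    by (intro that[of "\<lambda>i. poly (lagrange_basis node (mm 0) i)" "mm 0"])
      (simp add: detail_def interp_lagrange[OF assms])
next
  case False
  let ?n = "max (mm k) (mm (k - 1))"
  let ?l = "\<lambda>n i t. if i \<le> n then poly (lagrange_basis node n i) t else 0"
  have ext: "(\<Sum>i\<le>n. poly (lagrange_basis node n i) t *\<^sub>R g (node i)) =
      (\<Sum>i\<le>N. ?l n i t *\<^sub>R g (node i))" if "n \<le> N" for n N t and g :: "real \<Rightarrow> 'b"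
    using that by (intro sum.mono_neutral_cong_left) auto
  have "detail node mm k g =
      (\<lambda>t. \<Sum>i\<le>?n. (?l (mm k) i t - ?l (mm (k - 1)) i t) *\<^sub>R g (node i))"
    for g :: "real \<Rightarrow> 'b"
    using False ext[of "mm k" ?n] ext[of "mm (k - 1)" ?n]
    by (simp add: detail_def interp_lagrange[OF assms] scaleR_diff_left sum_subtractf)
  then show ?thesis
    by (intro that[of "\<lambda>i t. ?l (mm k) i t - ?l (mm (k - 1)) i t" ?n])
qed

lemma comp_fun_commute_detail_in:
  assumes "inj node"
  shows "comp_fun_commute
    (\<lambda>m. detail_in node mm m (i m) :: (('m \<Rightarrow> real) \<Rightarrow> 'h::real_vector) \<Rightarrow> _)"
proof
  fix m m' :: 'm
  show "detail_in node mm m' (i m') \<circ> detail_in node mm m (i m) =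
    (detail_in node mm m (i m) \<circ> detail_in node mm m' (i m') ::
       (('m \<Rightarrow> real) \<Rightarrow> 'h) \<Rightarrow> _)"
  proof (cases "m = m'")
    case False
    obtain n w where w: "\<And>g :: real \<Rightarrow> 'h. detail node mm (i m) g =
        (\<lambda>t. \<Sum>j\<le>(n::nat). w j t *\<^sub>R g (node j))"
      using detail_eq_sum[OF assms] by blast
    obtain n' w' where w': "\<And>g :: real \<Rightarrow> 'h. detail node mm (i m') g =
        (\<lambda>t. \<Sum>j\<le>(n'::nat). w' j t *\<^sub>R g (node j))"
      using detail_eq_sum[OF assms] by blast
    show ?thesis
      using False
      by (intro ext, simp add: detail_in_def w w' scaleR_sum_right fun_upd_twist mult.commute)
        (rule sum.swap)
  qed simp
qed

section \<open>Index sets and the adaptive algorithm\<close>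

definition monotone_index_set :: "('m \<Rightarrow> nat) set \<Rightarrow> bool" where
  "monotone_index_set \<Lambda> \<longleftrightarrow> (\<forall>i\<in>\<Lambda>. \<forall>m. i m \<ge> 1 \<longrightarrow> i(m := i m - 1) \<in> \<Lambda>)"

text \<open>The condition \<open>k - e\<^sub>m \<in> \<Lambda>\<close> includes \<open>k m \<ge> 1\<close>, since otherwise \<open>k - e\<^sub>m\<close> is no multi-index.\<close>

definition reduced_margin :: "('m \<Rightarrow> nat) set \<Rightarrow> ('m \<Rightarrow> nat) set" where
  "reduced_margin \<Lambda> =
     {k. k \<notin> \<Lambda> \<and> (\<exists>m. k m \<ge> 1 \<and> k(m := k m - 1) \<in> \<Lambda>)
        \<and> (\<forall>m. k m \<ge> 1 \<longrightarrow> k(m := k m - 1) \<in> \<Lambda>)}"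

definition indicator_eta ::
  "(nat \<Rightarrow> real) \<Rightarrow> (nat \<Rightarrow> nat) \<Rightarrow> ennreal
     \<Rightarrow> (('m::finite \<Rightarrow> real) \<Rightarrow> 'h::{real_inner, banach, second_countable_topology})
     \<Rightarrow> ('m \<Rightarrow> nat) \<Rightarrow> ennreal" where
  "indicator_eta node mm p u k = Lp_norm p param_measure (tensor_detail node mm k u)"

text \<open>
  \<open>U\<close> is a sequence of approximations the algorithm can generate, for some admissible choice
  \<open>kstar\<close> of maximizers and the resulting index sets \<open>\<Lambda>\<close>.
\<close>

definition gerstner_griebel ::
  "(nat \<Rightarrow> real) \<Rightarrow> (nat \<Rightarrow> nat) \<Rightarrow> ennreal
     \<Rightarrow> (('m::finite \<Rightarrow> real) \<Rightarrow> 'h::{real_inner, banach, second_countable_topology})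
     \<Rightarrow> (nat \<Rightarrow> ('m \<Rightarrow> real) \<Rightarrow> 'h) \<Rightarrow> bool" where
  "gerstner_griebel node mm p u U \<longleftrightarrow>
     (\<exists>\<Lambda> kstar. \<Lambda> 0 = {\<lambda>_. 0}
        \<and> (\<forall>n. is_arg_max (indicator_eta node mm p u) (\<lambda>k. k \<in> reduced_margin (\<Lambda> n)) (kstar n)
              \<and> \<Lambda> (Suc n) = \<Lambda> n \<union> {kstar n})
        \<and> (\<forall>n. U n = sparse_interp node mm (\<Lambda> n) u))"

end

theory Submission
  imports Defs "HOL-Real_Asymp.Real_Asymp"
begin

text \<open>
  The weighted summability makes \<open>norm (uc k)\<close> times any fixed polynomial growth in \<open>k\<close> at most
  a multiple of \<open>\<Prod>m. q ^ k m\<close> with \<open>q < 1\<close>. Hence the expansion converges uniformly, and, since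
  \<open>u\<close> is continuous and the measure has full support, it represents \<open>u\<close> at every point, in
  particular at the interpolation nodes. A univariate detail operator of level \<open>i\<close> annihilates
  polynomials of degree below \<open>i\<close>, so only terms with \<open>k \<ge> i\<close> contribute to the detail of index
  \<open>i\<close>. Splitting \<open>q = s * s\<close> bounds that detail by a multiple of \<open>\<Prod>m. s ^ i m\<close>, and the
  indicators are summable over all multi-indices. For summable indicators the greedy selection
  drives the sum over the reduced margin, and with it the error bound, to zero.
\<close>

section \<open>Unordered sums over multi-indices and growth bounds\<close>

lemma summable_on_UNIV_real_tail:
  fixes f :: "'a \<Rightarrow> real"
  assumes "f summable_on UNIV" "\<And>x. 0 \<le> f x" "0 < \<epsilon>"
  obtains A where "finite A" "\<And>B. finite B \<Longrightarrow> A \<inter> B = {} \<Longrightarrow> sum f B < \<epsilon>"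
proof -
  have "(sum f \<longlongrightarrow> infsum f UNIV) (finite_subsets_at_top UNIV)"
    using has_sum_infsum[OF assms(1)] by (simp add: has_sum_def)
  then have "\<forall>\<^sub>F A in finite_subsets_at_top UNIV. infsum f UNIV - \<epsilon> < sum f A"
    by (rule order_tendstoD) (use assms(3) in simp)
  then obtain A where A: "finite A" "infsum f UNIV - \<epsilon> < sum f A"
    by (auto simp: eventually_finite_subsets_at_top)
  have "sum f B < \<epsilon>" if "finite B" "A \<inter> B = {}" for B
  proof -
    have "sum f A + sum f B = sum f (A \<union> B)"
      using A that by (simp add: sum.union_disjoint)
    also have "\<dots> \<le> infsum f UNIV"
      using A that assms by (intro finite_sum_le_infsum) auto
    finally show ?thesis using A by simp
  qed
  with A show ?thesis using that by blast
qed

text \<open>A finite set of multi-indices lies in a box with sides \<open>{..N}\<close>. Over the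
  box the sum factors into truncated geometric series, one per coordinate, each at most
  \<open>1 / (1 - s)\<close>.\<close>

lemma summable_on_prod_power:
  fixes s :: real
  assumes "0 \<le> s" "s < 1"
  shows "(\<lambda>k :: 'm::finite \<Rightarrow> nat. \<Prod>m\<in>UNIV. s ^ k m) summable_on UNIV"
proof (rule nonneg_bdd_above_summable_on)
  show "bdd_above (sum (\<lambda>k :: 'm \<Rightarrow> nat. \<Prod>m\<in>UNIV. s ^ k m) ` {F. F \<subseteq> UNIV \<and> finite F})"
  proof (rule bdd_aboveI2)
    fix F :: "('m \<Rightarrow> nat) set" assume "F \<in> {F. F \<subseteq> UNIV \<and> finite F}"
    then have F: "finite F" by simp
    \<comment> \<open>The largest coordinate that occurs in \<open>F\<close>; inserting
      \<open>0\<close> keeps \<open>Max\<close> defined when \<open>F\<close> is empty.\<close>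
    define N where "N = Max (insert 0 ((\<lambda>(k, m). k m) ` (F \<times> UNIV)))"
    have N: "k m \<le> N" if "k \<in> F" for k m
      unfolding N_def using F that by (intro Max_ge) (auto intro!: rev_image_eqI[of "(k, m)"])
    have "(\<Sum>k\<in>F. \<Prod>m\<in>UNIV. s ^ k m) \<le> (\<Sum>k\<in>PiE (UNIV :: 'm set) (\<lambda>_. {..N}). \<Prod>m\<in>UNIV. s ^ k m)"
      using N assms by (intro sum_mono2 finite_PiE) (auto intro!: prod_nonneg)
    also have "\<dots> = (\<Prod>m\<in>(UNIV :: 'm set). \<Sum>j\<le>N. s ^ j)"
      by (subst prod_sum_PiE) auto
    also have "\<dots> \<le> (\<Prod>m\<in>(UNIV :: 'm set). 1 / (1 - s))"
    proof (rule prod_mono, intro conjI sum_nonneg)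
      have "(\<Sum>j\<le>N. s ^ j) \<le> (\<Sum>j. s ^ j)"
        using assms by (intro sum_le_suminf) (auto simp: summable_geometric)
      then show "(\<Sum>j\<le>N. s ^ j) \<le> 1 / (1 - s)" using assms by (simp add: suminf_geometric)
    qed (use assms in auto)
    finally show "(\<Sum>k\<in>F. \<Prod>m\<in>UNIV. s ^ k m) \<le> (\<Prod>m\<in>(UNIV :: 'm set). 1 / (1 - s))" .
  qed
qed (use assms in \<open>auto intro!: prod_nonneg\<close>)

text \<open>Since \<open>1 + a * k \<le> (1 + a) * (1 + k)\<close>, both factors reduce to powers of
  \<open>1 + k\<close>. The quotient of their product by \<open>b ^ k\<close> tends to zero, so it
  is bounded.\<close>

lemma polynomial_growth_le_exponential:
  fixes c d \<theta> \<tau> b :: real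
  assumes "0 \<le> c" "0 \<le> d" "0 \<le> \<theta>" "0 \<le> \<tau>" "1 < b"
  obtains K where "0 \<le> K" "\<And>k :: nat. (1 + c * k) powr \<theta> * (1 + d * k) powr \<tau> \<le> K * b ^ k"
proof -
  have "(\<lambda>k :: nat. (1 + real k) powr (\<theta> + \<tau>) / b ^ k) \<longlonglongrightarrow> 0"
    using assms(5) by real_asymp
  then have "Bseq (\<lambda>k :: nat. (1 + real k) powr (\<theta> + \<tau>) / b ^ k)"
    by (intro convergent_imp_Bseq convergentI)
  then obtain K0 where K0: "\<And>k. norm ((1 + real k) powr (\<theta> + \<tau>) / b ^ k) \<le> K0" "0 < K0"
    by (rule BseqE) blast
  define K where "K = (1 + c) powr \<theta> * (1 + d) powr \<tau> * K0"
  have lin: "(1 + a * k) powr t \<le> (1 + a) powr t * (1 + real k) powr t"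
    if "0 \<le> a" "0 \<le> t" for a t :: real and k :: nat
  proof -
    have "1 + a * k \<le> (1 + a) * (1 + real k)" using that by (simp add: algebra_simps)
    then have "(1 + a * k) powr t \<le> ((1 + a) * (1 + real k)) powr t"
      using that by (intro powr_mono2) auto
    then show ?thesis using that by (simp add: powr_mult)
  qed
  have "(1 + c * k) powr \<theta> * (1 + d * k) powr \<tau> \<le> K * b ^ k" for k :: nat
  proof -
    have "(1 + c * k) powr \<theta> * (1 + d * k) powr \<tau> \<le>
        ((1 + c) powr \<theta> * (1 + real k) powr \<theta>) * ((1 + d) powr \<tau> * (1 + real k) powr \<tau>)"
      using assms by (intro mult_mono lin) auto
    also have "\<dots> = (1 + c) powr \<theta> * (1 + d) powr \<tau> * (1 + real k) powr (\<theta> + \<tau>)"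
      by (simp add: powr_add mult_ac)
    also have "\<dots> \<le> (1 + c) powr \<theta> * (1 + d) powr \<tau> * (K0 * b ^ k)"
      using K0(1)[of k] assms(5) by (intro mult_left_mono) (auto simp: field_simps)
    finally show ?thesis by (simp add: K_def mult_ac)
  qed
  moreover have "0 \<le> K" using K0 by (simp add: K_def)
  ultimately show ?thesis using that by blast
qed

section \<open>Two-sided estimates for the Bochner norm\<close>

lemma Lp_norm_le_bound:
  assumes "prob_space M" "f \<in> borel_measurable M" "\<And>x. x \<in> space M \<Longrightarrow> norm (f x) \<le> B"
    "1 \<le> p" "0 \<le> B"
  shows "Lp_norm p M f \<le> ennreal B"
proof (cases "p = \<infinity>")
  case True
  have "esssup M (\<lambda>x. ennreal (norm (f x))) \<le> ennreal B"
    using assms by (intro esssup_I AE_I2) (auto intro!: ennreal_leI)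
  then show ?thesis using True assms by (simp add: Lp_norm_def)
next
  case False
  interpret prob_space M by fact
  define r where "r = enn2real p"
  define I where "I = (\<integral>\<^sup>+ x. ennreal (norm (f x) powr r) \<partial>M)"
  have r: "1 \<le> r"
    using assms(4) False enn2real_mono[of 1 p] by (auto simp: r_def top.not_eq_extremum)
  have "I \<le> (\<integral>\<^sup>+ x. ennreal (B powr r) \<partial>M)"
    unfolding I_def using assms r by (intro nn_integral_mono ennreal_leI powr_mono2) auto
  then have I: "I \<le> ennreal (B powr r)" by (simp add: emeasure_space_1)
  then have "enn2real I \<le> B powr r"
    using enn2real_mono[OF I] by simp
  then have "enn2real I powr (1 / r) \<le> (B powr r) powr (1 / r)"
    using r by (intro powr_mono2) auto
  also have "\<dots> = B" using r assms by (simp add: powr_powr)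
  finally have "ennreal (enn2real I powr (1 / r)) \<le> ennreal B" by (rule ennreal_leI)
  moreover have "I \<noteq> \<infinity>" using I by (auto simp: top_unique)
  ultimately show ?thesis
    using assms(2) False unfolding Lp_norm_def r_def[symmetric] I_def[symmetric] Let_def by simp
qed

text \<open>Markov's inequality, arranged so that \<open>d\<close> depends only on \<open>B\<close>,
  \<open>\<epsilon>\<close> and \<open>p\<close>: one threshold then serves all partial sums of an
  expansion. A non-measurable \<open>f\<close> satisfies the bound because its norm is
  infinite.\<close>

lemma Lp_norm_lower_bound:
  assumes "prob_space M" "B \<in> sets M" "emeasure M B > 0" "0 < \<epsilon>" "1 \<le> p"
  obtains d where "0 < d"
    "\<And>f :: 'a \<Rightarrow> 'h::{banach, second_countable_topology}.
       (\<And>x. x \<in> B \<Longrightarrow> \<epsilon> \<le> norm (f x)) \<Longrightarrow> ennreal d \<le> Lp_norm p M f"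
proof (cases "p = \<infinity>")
  case True
  have "ennreal \<epsilon> \<le> Lp_norm p M f" if f: "\<And>x. x \<in> B \<Longrightarrow> \<epsilon> \<le> norm (f x)" for f :: "'a \<Rightarrow> 'h"
  proof (cases "f \<in> borel_measurable M")
    case meas: True
    show ?thesis
    proof (rule ccontr)
      assume "\<not> ?thesis"
      then have less: "esssup M (\<lambda>x. ennreal (norm (f x))) < ennreal \<epsilon>"
        using True meas by (simp add: Lp_norm_def)
      have "AE x in M. x \<notin> B"
        using esssup_AE[where M = M and f = "\<lambda>x. ennreal (norm (f x))"]
      proof eventually_elim
        case (elim x)
        with less have "ennreal (norm (f x)) < ennreal \<epsilon>" by simp
        then show ?case using f[of x] assms(4) by (auto simp: ennreal_less_iff)
      qed
      then have "emeasure M B = 0"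
        using assms(2) by (subst (asm) AE_iff_measurable[OF _ refl])
          (auto simp: Int_absorb1 sets.sets_into_space Collect_conj_eq)
      then show False using assms(3) by simp
    qed
  qed (simp add: Lp_norm_def)
  then show ?thesis using that assms(4) by blast
next
  case False
  interpret prob_space M by fact
  define r where "r = enn2real p"
  have r: "1 \<le> r"
    using assms(5) False enn2real_mono[of 1 p] by (auto simp: r_def top.not_eq_extremum)
  \<comment> \<open>This is \<open>\<epsilon>\<close> times the \<open>r\<close>-th root of the
    measure of \<open>B\<close>, the norm of \<open>\<epsilon>\<close> times the indicator of
    \<open>B\<close>.\<close>
  define d where "d = (\<epsilon> powr r * measure M B) powr (1 / r)"
  have mB: "0 < measure M B"
    using assms(3) by (simp add: emeasure_eq_measure)
  have "ennreal d \<le> Lp_norm p M f" if f: "\<And>x. x \<in> B \<Longrightarrow> \<epsilon> \<le> norm (f x)" for f :: "'a \<Rightarrow> 'h"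
  proof (cases "f \<in> borel_measurable M \<and> (\<integral>\<^sup>+ x. ennreal (norm (f x) powr r) \<partial>M) \<noteq> \<infinity>")
    case True
    define I where "I = (\<integral>\<^sup>+ x. ennreal (norm (f x) powr r) \<partial>M)"
    have "ennreal (\<epsilon> powr r * measure M B) = (\<integral>\<^sup>+ x. ennreal (\<epsilon> powr r) * indicator B x \<partial>M)"
      using assms(2) by (simp add: nn_integral_cmult_indicator emeasure_eq_measure ennreal_mult)
    also have "\<dots> \<le> I"
      unfolding I_def using f assms(4) r
      by (intro nn_integral_mono) (auto split: split_indicator intro!: ennreal_leI powr_mono2)
    finally have "ennreal (\<epsilon> powr r * measure M B) \<le> I" .
    then have "enn2real (ennreal (\<epsilon> powr r * measure M B)) \<le> enn2real I"
      using True by (intro enn2real_mono) (auto simp: I_def top.not_eq_extremum)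
    then have "\<epsilon> powr r * measure M B \<le> enn2real I" by simp
    then have "d \<le> enn2real I powr (1 / r)"
      unfolding d_def using r by (intro powr_mono2) auto
    then show ?thesis
      using True False by (auto simp: Lp_norm_def Let_def ennreal_leI simp flip: r_def I_def)
  qed (use False in \<open>auto simp: Lp_norm_def Let_def simp flip: r_def\<close>)
  moreover have "0 < d" using mB assms(4) by (simp add: d_def)
  ultimately show ?thesis using that by blast
qed

section \<open>Measurability and full support of the parameter measure\<close>

abbreviation (input) unit_interval_measure :: "real measure" where
  "unit_interval_measure \<equiv> uniform_measure (restrict_space lborel {-1..1}) {-1..1}"

lemma prob_space_unit_interval_measure: "prob_space unit_interval_measure"
  by (rule prob_space_uniform_measure) (auto simp: emeasure_restrict_space)

lemma measurable_param_component:
  "(\<lambda>y :: 'm::finite \<Rightarrow> real. y m) \<in> borel_measurable param_measure"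
proof -
  have "(\<lambda>y. y m) \<in> measurable (param_measure :: ('m \<Rightarrow> real) measure) unit_interval_measure"
    unfolding param_measure_def by (rule measurable_component_singleton) simp
  moreover have "(\<lambda>t. t) \<in> measurable unit_interval_measure borel"
    using measurable_restrict_space1[of "\<lambda>t. t" lborel borel "{-1..1}"]
    by (simp add: uniform_measure_def)
  ultimately show ?thesis by (rule measurable_compose)
qed

lemma measurable_param_poly:
  "(\<lambda>y :: 'm::finite \<Rightarrow> real. poly q (y m)) \<in> borel_measurable param_measure"
  by (intro measurable_compose[OF measurable_param_component] borel_measurable_continuous_onI
      continuous_intros)

text \<open>A detail operator evaluates its argument at points with one coordinate replaced by a
  node. The underlying space is the cube itself, so the new coordinate has to lie in the
  interval.\<close>

lemma measurable_param_upd: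
  fixes m :: "'m::finite"
  assumes "t \<in> {-1..1}"
  shows "(\<lambda>y. y(m := t)) \<in> measurable param_measure param_measure"
  unfolding param_measure_def
  by (rule measurable_fun_upd[where J = UNIV])
    (use assms in \<open>auto simp: space_restrict_space\<close>)

lemma emeasure_param_open_box_pos:
  fixes z :: "'m::finite \<Rightarrow> real"
  assumes "z \<in> param_domain" "\<And>m. open (X m)" "\<And>m. z m \<in> X m"
  defines "B \<equiv> {y \<in> param_domain. \<forall>m. y m \<in> X m}"
  shows "B \<in> sets param_measure" "0 < emeasure param_measure B"
proof -
  interpret product_prob_space "\<lambda>_ :: 'm. unit_interval_measure" UNIV
    by (intro product_prob_spaceI prob_space_unit_interval_measure)
  have B: "B = PiE UNIV (\<lambda>m. X m \<inter> {-1..1})"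
    by (auto simp: B_def param_domain_def PiE_UNIV_domain)
  have S: "X m \<inter> {-1..1} \<in> sets unit_interval_measure" for m
    using assms(2)[of m] by (auto simp: sets_restrict_space intro!: image_eqI[of _ _ "X m"])
  show "B \<in> sets param_measure"
    unfolding B param_measure_def using S by (intro sets_PiM_I_finite) auto
  have pos: "emeasure unit_interval_measure (X m \<inter> {-1..1}) \<noteq> 0" for m
  proof -
    obtain e where e: "e > 0" "cball (z m) e \<subseteq> X m"
      using assms(2,3)[of m] open_contains_cball by blast
    \<comment> \<open>The interval around \<open>z m\<close> is clipped to \<open>{-1..1}\<close>.
      It keeps positive length even if \<open>z m\<close> is an endpoint.\<close>
    define a where "a = max (-1) (z m - e)"
    define b where "b = min 1 (z m + e)"
    have z: "z m \<in> {-1..1}" using assms(1) by (simp add: param_domain_def)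
    have ab: "a < b" using z e by (auto simp: a_def b_def)
    have "{a..b} \<subseteq> X m \<inter> {-1..1}"
      using e(2) by (auto simp: a_def b_def cball_def dist_real_def subset_eq abs_le_iff)
    then have "ennreal (b - a) \<le> emeasure lborel (X m \<inter> {-1..1})"
      using ab assms(2)[of m] emeasure_mono[of "{a..b}" "X m \<inter> {-1..1}" lborel] by simp
    then have "emeasure lborel (X m \<inter> {-1..1}) \<noteq> 0"
      using ab by auto
    moreover have "emeasure unit_interval_measure (X m \<inter> {-1..1}) =
        emeasure lborel (X m \<inter> {-1..1}) / emeasure lborel {-1..1::real}"
      using S[of m] by (subst emeasure_uniform_measure)
        (auto simp: emeasure_restrict_space Int_ac sets_restrict_space intro!: image_eqI[of _ _ UNIV])
    ultimately show ?thesis by (simp add: ennreal_divide_eq_0_iff)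
  qed
  have "emeasure param_measure B = (\<Prod>m\<in>UNIV. emeasure unit_interval_measure (X m \<inter> {-1..1}))"
    unfolding B param_measure_def using S by (intro emeasure_PiM) auto
  then show "0 < emeasure param_measure B"
    using pos by (simp add: zero_less_iff_neq_zero)
qed

section \<open>Univariate detail operators\<close>

text \<open>Nestedness lets both Lagrange forms be collected over the nodes of the finer level.
  Explicit polynomial weights make continuity and measurability immediate. The guard
  \<open>k \<noteq> 0\<close> matters because \<open>k - 1\<close> is \<open>0\<close> at
  \<open>k = 0\<close>, where the two terms would cancel.\<close>

definition detail_weight :: "(nat \<Rightarrow> real) \<Rightarrow> (nat \<Rightarrow> nat) \<Rightarrow> nat \<Rightarrow> nat \<Rightarrow> real poly" where
  "detail_weight node mm k i = lagrange_basis node (mm k) i -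
     (if k \<noteq> 0 \<and> i \<le> mm (k - 1) then lagrange_basis node (mm (k - 1)) i else 0)"

lemma detail_eq_weights:
  fixes g :: "real \<Rightarrow> 'b::real_vector"
  assumes "inj node" "strict_mono mm"
  shows "detail node mm k g = (\<lambda>t. \<Sum>i\<le>mm k. poly (detail_weight node mm k i) t *\<^sub>R g (node i))"
proof (cases "k = 0")
  case True
  then show ?thesis by (simp add: detail_def interp_lagrange[OF assms(1)] detail_weight_def)
next
  case False
  have le: "mm (k - 1) \<le> mm k" using assms(2) by (simp add: strict_mono_less_eq)
  have "(\<Sum>i\<le>mm (k - 1). poly (lagrange_basis node (mm (k - 1)) i) t *\<^sub>R g (node i)) =
      (\<Sum>i\<le>mm k. poly (if i \<le> mm (k - 1) then lagrange_basis node (mm (k - 1)) i else 0) t *\<^sub>R g (node i))"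
    for t
    using le by (intro sum.mono_neutral_cong_left) auto
  then show ?thesis
    using False
    by (simp add: detail_def interp_lagrange[OF assms(1)] detail_weight_def scaleR_diff_left sum_subtractf)
qed

lemma detail_in_eq_weights:
  fixes f :: "('m \<Rightarrow> real) \<Rightarrow> 'b::real_vector"
  assumes "inj node" "strict_mono mm"
  shows "detail_in node mm m k f y =
    (\<Sum>j\<le>mm k. poly (detail_weight node mm k j) (y m) *\<^sub>R f (y(m := node j)))"
  by (simp add: detail_in_def detail_eq_weights[OF assms])

lemma interp_poly:
  fixes q :: "real poly"
  assumes "inj node" "degree q \<le> mm k"
  shows "interp node mm k (poly q) = poly q"
proof
  fix t
  have "poly q t = poly (\<Sum>i\<le>mm k. smult (poly q (node i)) (lagrange_basis node (mm k) i)) t"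
    using real_poly_lagrange[OF assms] by simp
  then show "interp node mm k (poly q) t = poly q t"
    by (simp add: interp_lagrange[OF assms(1)] poly_sum mult.commute)
qed

text \<open>A strictly increasing \<open>mm\<close> satisfies \<open>k - 1 \<le> mm (k - 1)\<close>.
  Hence the interpolants of levels \<open>k - 1\<close> and \<open>k\<close> both reproduce a
  polynomial of degree below \<open>k\<close>, and their difference vanishes.\<close>

lemma detail_poly_eq_0:
  fixes q :: "real poly"
  assumes "inj node" "strict_mono mm" "degree q < k"
  shows "detail node mm k (poly q) t = 0"
proof -
  have "k - 1 \<le> mm (k - 1)" using assms(2) by (rule strict_mono_imp_increasing)
  moreover have "mm (k - 1) \<le> mm k" using assms(2) by (simp add: strict_mono_less_eq)
  ultimately have "degree q \<le> mm (k - 1)" "degree q \<le> mm k" using assms(3) by auto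
  then show ?thesis using assms(1,3) by (simp add: detail_def interp_poly)
qed

text \<open>A real-valued supremum dominates its members only over a bounded set; compactness of the
  interval provides the bound.\<close>

lemma abs_le_sup_norm:
  assumes "continuous_on {-1..1} g" "t \<in> {-1..1}"
  shows "\<bar>g t\<bar> \<le> sup_norm g"
proof -
  have "bounded ((\<lambda>t. \<bar>g t\<bar>) ` {-1..1})"
    using assms(1) by (intro compact_imp_bounded compact_continuous_image continuous_intros) auto
  then show ?thesis
    unfolding sup_norm_def using assms(2) by (intro cSUP_upper bounded_imp_bdd_above)
qed

text \<open>The operator norm ranges only over functions that are nonzero somewhere on the interval.
  A function vanishing there is treated separately: it vanishes at all nodes, and so its detail is
  zero.\<close>

lemma abs_detail_le:
  fixes g :: "real \<Rightarrow> real"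
  assumes "inj node" "strict_mono mm" "range node \<subseteq> {-1..1}" "continuous_on {-1..1} g"
    "t \<in> {-1..1}" "detail_opnorm node mm k \<le> ennreal K" "0 \<le> K"
  shows "\<bar>detail node mm k g t\<bar> \<le> K * sup_norm g"
proof (cases "\<exists>t\<in>{-1..1}. g t \<noteq> 0")
  case True
  then obtain s where s: "s \<in> {-1..1}" "g s \<noteq> 0" by blast
  have pos: "0 < sup_norm g" using abs_le_sup_norm[OF assms(4) s(1)] s(2) by linarith
  have "ennreal (sup_norm (detail node mm k g) / sup_norm g) \<le> detail_opnorm node mm k"
    unfolding detail_opnorm_def using assms(4) True by (intro SUP_upper) auto
  also note assms(6)
  finally have "sup_norm (detail node mm k g) / sup_norm g \<le> K"
    using assms(7) by (simp add: ennreal_le_iff)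
  then have "sup_norm (detail node mm k g) \<le> K * sup_norm g"
    using pos by (simp add: pos_divide_le_eq)
  moreover have "continuous_on {-1..1} (detail node mm k g)"
    unfolding detail_eq_weights[OF assms(1,2)] by (intro continuous_intros)
  ultimately show ?thesis using abs_le_sup_norm[OF _ assms(5)] by fastforce
next
  case False
  then have "detail node mm k g t = 0"
    using assms(3) by (simp add: detail_eq_weights[OF assms(1,2)] image_subset_iff)
  moreover have "0 \<le> sup_norm g" using abs_le_sup_norm[OF assms(4,5)] by linarith
  ultimately show ?thesis using assms(7) by simp
qed

section \<open>Tensorized details of products, sums and limits\<close>

lemma detail_in_product:
  fixes a :: "'b::real_vector" and h :: "'m::finite \<Rightarrow> real \<Rightarrow> real"
  assumes "inj node" "strict_mono mm"
  shows "detail_in node mm x k (\<lambda>y. (\<Prod>m\<in>UNIV. h m (y m)) *\<^sub>R a) =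
    (\<lambda>y. (\<Prod>m\<in>UNIV. (h(x := detail node mm k (h x))) m (y m)) *\<^sub>R a)"
proof
  fix y
  have split: "(\<Prod>m\<in>UNIV. g m (z m)) = g x (z x) * (\<Prod>m\<in>UNIV - {x}. g m (z m))"
    for g :: "'m \<Rightarrow> real \<Rightarrow> real" and z
    by (rule prod.remove) auto
  have 1: "(\<Prod>m\<in>UNIV - {x}. h m ((y(x := t)) m)) = (\<Prod>m\<in>UNIV - {x}. h m (y m))" for t
    by (rule prod.cong) auto
  have 2: "(\<Prod>m\<in>UNIV - {x}. (h(x := g)) m (y m)) = (\<Prod>m\<in>UNIV - {x}. h m (y m))" for g
    by (rule prod.cong) auto
  show "detail_in node mm x k (\<lambda>y. (\<Prod>m\<in>UNIV. h m (y m)) *\<^sub>R a) y =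
      (\<Prod>m\<in>UNIV. (h(x := detail node mm k (h x))) m (y m)) *\<^sub>R a"
    unfolding detail_in_eq_weights[OF assms] split 1 2
    by (simp add: detail_eq_weights[OF assms] sum_distrib_left mult_ac flip: scaleR_sum_left)
qed

text \<open>Peeling one coordinate off the fold relies on commutation of the coordinatewise
  operators. It is the induction step for every property of \<open>tensor_detail\<close>
  below.\<close>

lemma fold_detail_in_insert:
  fixes f :: "('m::finite \<Rightarrow> real) \<Rightarrow> 'b::real_vector"
  assumes "inj node" "x \<notin> S"
  shows "Finite_Set.fold (\<lambda>m f. detail_in node mm m (i m) f) f (insert x S) =
    detail_in node mm x (i x) (Finite_Set.fold (\<lambda>m f. detail_in node mm m (i m) f) f S)"
proof -
  interpret comp_fun_commute "\<lambda>m. detail_in node mm m (i m) :: (('m \<Rightarrow> real) \<Rightarrow> 'b) \<Rightarrow> _"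
    by (rule comp_fun_commute_detail_in[OF assms(1)])
  show ?thesis using assms(2) by (intro fold_insert) auto
qed

lemma tensor_detail_product:
  fixes a :: "'b::real_vector" and h :: "'m::finite \<Rightarrow> real \<Rightarrow> real"
  assumes "inj node" "strict_mono mm"
  shows "tensor_detail node mm i (\<lambda>y. (\<Prod>m\<in>UNIV. h m (y m)) *\<^sub>R a) =
    (\<lambda>y. (\<Prod>m\<in>UNIV. detail node mm (i m) (h m) (y m)) *\<^sub>R a)"
proof -
  \<comment> \<open>\<open>H S\<close> is the family of factors after the operators with coordinates
    in \<open>S\<close> have acted.\<close>
  define H where "H S m = (if m \<in> S then detail node mm (i m) (h m) else h m)" for S m
  have "Finite_Set.fold (\<lambda>m f. detail_in node mm m (i m) f) (\<lambda>y. (\<Prod>m\<in>UNIV. h m (y m)) *\<^sub>R a) S =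
      (\<lambda>y. (\<Prod>m\<in>UNIV. H S m (y m)) *\<^sub>R a)"
    if "finite S" for S :: "'m set"
    using that
  proof induction
    case (insert x S)
    have "(H S)(x := detail node mm (i x) (H S x)) = H (insert x S)"
      using insert.hyps by (auto simp: H_def)
    then show ?case
      unfolding fold_detail_in_insert[OF assms(1) insert.hyps(2)] insert.IH detail_in_product[OF assms]
      by simp
  qed (simp add: H_def)
  then show ?thesis by (simp add: tensor_detail_def H_def)
qed

lemma tensor_detail_sum:
  fixes f :: "'a \<Rightarrow> ('m::finite \<Rightarrow> real) \<Rightarrow> 'b::real_vector"
  assumes "inj node" "strict_mono mm"
  shows "tensor_detail node mm i (\<lambda>y. \<Sum>k\<in>A. f k y) = (\<lambda>y. \<Sum>k\<in>A. tensor_detail node mm i (f k) y)"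
proof -
  have "Finite_Set.fold (\<lambda>m f. detail_in node mm m (i m) f) (\<lambda>y. \<Sum>k\<in>A. f k y) S =
      (\<lambda>y. \<Sum>k\<in>A. Finite_Set.fold (\<lambda>m f. detail_in node mm m (i m) f) (f k) S y)"
    if "finite S" for S :: "'m set"
    using that
  proof induction
    case (insert x S)
    show ?case
      unfolding fold_detail_in_insert[OF assms(1) insert.hyps(2)] insert.IH
      by (auto simp: detail_in_eq_weights[OF assms] scaleR_sum_right intro!: ext sum.swap)
  qed simp
  then show ?thesis by (simp add: tensor_detail_def)
qed

text \<open>The value at \<open>y\<close> is a fixed linear combination of finitely many values of
  the argument at points of the cube. Pointwise convergence therefore passes through, whereas
  convergence in the Bochner norm alone would not control values at nodes.\<close>

lemma tendsto_detail_in: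
  fixes f :: "('m::finite \<Rightarrow> real) \<Rightarrow> 'b::real_normed_vector"
  assumes "inj node" "strict_mono mm" "range node \<subseteq> {-1..1}"
    "\<And>y. y \<in> param_domain \<Longrightarrow> ((\<lambda>a. F a y) \<longlongrightarrow> f y) G" "y \<in> param_domain"
  shows "((\<lambda>a. detail_in node mm m k (F a) y) \<longlongrightarrow> detail_in node mm m k f y) G"
proof -
  have "y(m := node j) \<in> param_domain" for j
    using assms(3,5) by (simp add: param_domain_def image_subset_iff)
  then show ?thesis
    unfolding detail_in_eq_weights[OF assms(1,2)] by (intro tendsto_intros assms(4))
qed

lemma tendsto_tensor_detail:
  fixes f :: "('m::finite \<Rightarrow> real) \<Rightarrow> 'b::real_normed_vector"
  assumes "inj node" "strict_mono mm" "range node \<subseteq> {-1..1}"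
    "\<And>y. y \<in> param_domain \<Longrightarrow> ((\<lambda>a. F a y) \<longlongrightarrow> f y) G" "y \<in> param_domain"
  shows "((\<lambda>a. tensor_detail node mm i (F a) y) \<longlongrightarrow> tensor_detail node mm i f y) G"
proof -
  \<comment> \<open>The claim covers the whole cube because the induction step evaluates the
    previous stage at points moved to nodes.\<close>
  have "\<forall>y\<in>param_domain. ((\<lambda>a. Finite_Set.fold (\<lambda>m f. detail_in node mm m (i m) f) (F a) S y) \<longlongrightarrow>
      Finite_Set.fold (\<lambda>m f. detail_in node mm m (i m) f) f S y) G"
    if "finite S" for S :: "'m set"
    using that
  proof induction
    case empty
    then show ?case using assms(4) by simp
  next
    case (insert x S)
    then show ?case
      unfolding fold_detail_in_insert[OF assms(1) insert.hyps(2)]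
      by (intro ballI tendsto_detail_in[OF assms(1-3)]) auto
  qed
  then show ?thesis using assms(5) by (simp add: tensor_detail_def)
qed

text \<open>A pointwise bound controls \<open>Lp_norm\<close> only for measurable functions, since
  the norm of any other function is infinite.\<close>

lemma measurable_tensor_detail:
  fixes f :: "('m::finite \<Rightarrow> real) \<Rightarrow> 'b::{banach, second_countable_topology}"
  assumes "inj node" "strict_mono mm" "range node \<subseteq> {-1..1}" "f \<in> borel_measurable param_measure"
  shows "tensor_detail node mm i f \<in> borel_measurable param_measure"
proof -
  have "Finite_Set.fold (\<lambda>m f. detail_in node mm m (i m) f) f S \<in> borel_measurable param_measure"
    if "finite S" for S :: "'m set"
    using that
  proof induction
    case (insert x S)
    have upd: "(\<lambda>y. Finite_Set.fold (\<lambda>m f. detail_in node mm m (i m) f) f S (y(x := node j)))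
        \<in> borel_measurable param_measure" for j
      using assms(3) by (intro measurable_compose[OF measurable_param_upd insert.IH]) (simp add: image_subset_iff)
    show ?case
      unfolding fold_detail_in_insert[OF assms(1) insert.hyps(2)]
      by (subst detail_in_eq_weights[OF assms(1,2), abs_def])
        (intro borel_measurable_sum borel_measurable_scaleR upd measurable_param_poly)
  qed (use assms(4) in simp)
  then show ?thesis by (simp add: tensor_detail_def)
qed

section \<open>Greedy selection with summable indicators\<close>

lemma monotone_index_set_insert_reduced_margin:
  assumes "monotone_index_set \<Lambda>" "k \<in> reduced_margin \<Lambda>"
  shows "monotone_index_set (\<Lambda> \<union> {k})"
  using assms unfolding monotone_index_set_def reduced_margin_def by blast

text \<open>
  An index in the reduced margin of the union \<open>\<Union>n. \<Lambda> n\<close> is a candidate at all late steps but is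
  never selected, so its indicator is dominated by those of the selected indices, which tend to
  zero, and hence vanishes. So only the indices selected after step \<open>n\<close> contribute to the sum
  over the reduced margin of \<open>\<Lambda> n\<close>.
\<close>

lemma greedy_margin_sum_tendsto_0:
  fixes \<eta> :: "('m::finite \<Rightarrow> nat) \<Rightarrow> ennreal"
  assumes step: "\<And>n. is_arg_max \<eta> (\<lambda>k. k \<in> reduced_margin (\<Lambda> n)) (kstar n)"
      "\<And>n. \<Lambda> (Suc n) = \<Lambda> n \<union> {kstar n}"
    and \<eta>: "\<And>k. \<eta> k \<le> ennreal (e k)" "\<And>k. 0 \<le> e k" "e summable_on UNIV"
  shows "(\<lambda>n. \<Sum>k\<in>reduced_margin (\<Lambda> n). \<eta> k) \<longlonglongrightarrow> 0"
proof -
  have mono: "\<Lambda> a \<subseteq> \<Lambda> b" if "a \<le> b" for a b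
    using that by (induction rule: dec_induct) (auto simp: step(2))
  have kmem: "kstar n \<in> reduced_margin (\<Lambda> n)" for n
    using step(1)[of n] by (simp add: is_arg_max_def)
  have kmax: "\<eta> k \<le> \<eta> (kstar n)" if "k \<in> reduced_margin (\<Lambda> n)" for k n
    using step(1)[of n] that by (auto simp: is_arg_max_def not_less)
  \<comment> \<open>A selected index belongs to all later index sets, whereas every selection is
    made outside the current one.\<close>
  have new: "kstar a \<noteq> kstar b" if "a < b" for a b
  proof -
    have "kstar a \<in> \<Lambda> b" using mono[of "Suc a" b] that step(2)[of a] by auto
    moreover have "kstar b \<notin> \<Lambda> b" using kmem[of b] by (simp add: reduced_margin_def)
    ultimately show ?thesis by metis
  qed
  then have inj: "inj kstar" by (metis injI linorder_neqE_nat)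
  define L where "L = (\<Union>n. \<Lambda> n)"
  have stay: "\<forall>\<^sub>F n in sequentially. k \<in> \<Lambda> n" if "k \<in> L" for k
    using that mono by (auto simp: L_def eventually_sequentially)
  have zero: "\<eta> k = 0" if k: "k \<in> reduced_margin L" for k
  proof -
    have small: "\<eta> k \<le> ennreal \<epsilon>" if \<epsilon>: "0 < \<epsilon>" for \<epsilon>
    proof -
      obtain A where A: "finite A" "\<And>B. finite B \<Longrightarrow> A \<inter> B = {} \<Longrightarrow> sum e B < \<epsilon>"
        using summable_on_UNIV_real_tail[OF \<eta>(3,2) \<epsilon>] by blast
      have "\<forall>\<^sub>F n in sequentially. \<forall>m. k m \<ge> 1 \<longrightarrow> k(m := k m - 1) \<in> \<Lambda> n"
        using k stay by (auto simp: eventually_all_finite reduced_margin_def intro!: eventually_all_finite)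
      \<comment> \<open>By injectivity \<open>kstar\<close> meets the finite set \<open>A\<close>
        only finitely often. Outside \<open>A\<close> every single value of \<open>e\<close> is
        below \<open>\<epsilon>\<close>.\<close>
      moreover have "\<forall>\<^sub>F n in sequentially. kstar n \<notin> A"
      proof -
        have "finite (kstar -` A)" using A(1) inj by (rule finite_vimageI)
        then show ?thesis
          by (simp add: eventually_cofinite flip: cofinite_eq_sequentially vimage_def)
      qed
      ultimately have "\<forall>\<^sub>F n in sequentially. (\<forall>m. k m \<ge> 1 \<longrightarrow> k(m := k m - 1) \<in> \<Lambda> n) \<and> kstar n \<notin> A"
        by (rule eventually_conj)
      then obtain n where n: "\<forall>m. k m \<ge> 1 \<longrightarrow> k(m := k m - 1) \<in> \<Lambda> n" "kstar n \<notin> A"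
        by (auto simp: eventually_sequentially)
      have "k \<in> reduced_margin (\<Lambda> n)"
        using k n(1) by (auto simp: reduced_margin_def L_def)
      then have "\<eta> k \<le> ennreal (e (kstar n))" using kmax \<eta>(1) order.trans by blast
      also have "\<dots> \<le> ennreal \<epsilon>"
        using A(2)[of "{kstar n}"] n(2) by (intro ennreal_leI) simp
      finally show ?thesis .
    qed
    then show ?thesis by (metis ennreal_le_epsilon add_0 le_zero_eq ennreal_zero_less_top)
  qed
  show ?thesis
  proof (rule order_tendstoI)
    fix b :: ennreal assume "0 < b"
    then obtain \<epsilon> where \<epsilon>: "0 < \<epsilon>" "ennreal \<epsilon> < b"
      by (metis dense ennreal_cases ennreal_less_zero_iff less_top_ennreal order.strict_trans top.not_eq_extremum)
    obtain A where A: "finite A" "\<And>B. finite B \<Longrightarrow> A \<inter> B = {} \<Longrightarrow> sum e B < \<epsilon>"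
      using summable_on_UNIV_real_tail[OF \<eta>(3,2) \<epsilon>(1)] by blast
    \<comment> \<open>Once \<open>\<Lambda> n\<close> has absorbed \<open>A \<inter> L\<close>, the
      margin, being disjoint from \<open>\<Lambda> n\<close>, meets \<open>L\<close> only outside
      \<open>A\<close>, where the tail of \<open>e\<close> is small.\<close>
    have "\<forall>\<^sub>F n in sequentially. \<forall>k\<in>A \<inter> L. k \<in> \<Lambda> n"
      using A(1) stay by (intro eventually_ball_finite) auto
    then show "\<forall>\<^sub>F n in sequentially. (\<Sum>k\<in>reduced_margin (\<Lambda> n). \<eta> k) < b"
    proof eventually_elim
      case (elim n)
      define R where "R = reduced_margin (\<Lambda> n)"
      \<comment> \<open>The predecessors of \<open>k\<close> lie in \<open>\<Lambda> n\<close>,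
        hence in \<open>L\<close>, so \<open>zero\<close> applies to \<open>k\<close>.\<close>
      have RL: "k \<in> reduced_margin L" if "k \<in> R" "k \<notin> L" for k
        using that by (auto simp: R_def reduced_margin_def L_def)
      \<comment> \<open>A sum over an infinite set is zero by convention, so the estimate concerns
        finite \<open>R\<close>.\<close>
      have "sum \<eta> R < b"
      proof (cases "finite R")
        case True
        have "sum \<eta> R = sum \<eta> (R \<inter> L)"
          using True zero RL by (intro sum.mono_neutral_right) auto
        also have "\<dots> \<le> (\<Sum>k\<in>R \<inter> L. ennreal (e k))" using \<eta>(1) by (rule sum_mono)
        also have "\<dots> = ennreal (sum e (R \<inter> L))" using \<eta>(2) by simp
        also have "\<dots> \<le> ennreal \<epsilon>"
          using A(2)[of "R \<inter> L"] True elim by (intro ennreal_leI less_imp_le) (auto simp: R_def reduced_margin_def)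
        finally show ?thesis using \<epsilon>(2) by simp
      qed (use \<open>0 < b\<close> in simp)
      then show ?case by (simp add: R_def)
    qed
  qed simp
qed

section \<open>From norm convergence to pointwise convergence\<close>

text \<open>The superlevel set of \<open>g\<close> is relatively open, so it contains the trace on
  the cube of an open box around \<open>z\<close>. Full support gives that trace positive
  measure.\<close>

lemma continuous_param_neighbourhood:
  fixes g :: "('m::finite \<Rightarrow> real) \<Rightarrow> real"
  assumes "continuous_on param_domain g" "z \<in> param_domain" "a < g z"
  obtains B where "B \<in> sets param_measure" "0 < emeasure param_measure B" "B \<subseteq> param_domain"
    "\<And>y. y \<in> B \<Longrightarrow> a < g y"
proof -
  obtain O' where O': "open O'" "O' \<inter> param_domain = g -` {a<..} \<inter> param_domain"
    using assms(1) open_greaterThan unfolding continuous_on_open_invariant by blast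
  have "z \<in> O'" using O'(2) assms(2,3) by blast
  moreover have "openin (product_topology (\<lambda>_ :: 'm. euclideanreal) UNIV) O'"
    using O'(1) by (simp add: open_fun_def)
  ultimately obtain X where X: "z \<in> PiE UNIV X" "\<And>m. open (X m)" "PiE UNIV X \<subseteq> O'"
    using product_topology_open_contains_basis[of "\<lambda>_ :: 'm. euclideanreal" UNIV O' z] by auto
  define B where "B = {y \<in> param_domain. \<forall>m. y m \<in> X m}"
  have "B \<in> sets param_measure" "0 < emeasure param_measure B"
    unfolding B_def using X(1,2) by (auto intro!: emeasure_param_open_box_pos[OF assms(2)])
  moreover have "a < g y" if "y \<in> B" for y
    using that X(3) O'(2) by (auto simp: B_def PiE_UNIV_domain)
  ultimately show ?thesis using that by (auto simp: B_def)
qed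

text \<open>
  The uniform majorant turns a deviation of the partial sums from \<open>u\<close> at a single point into one
  that, by continuity, persists on a set of positive measure for all larger partial sums.
\<close>

lemma pointwise_convergent_expansion:
  fixes u :: "('m::finite \<Rightarrow> real) \<Rightarrow> 'h::{banach, second_countable_topology}"
    and T :: "'k \<Rightarrow> ('m \<Rightarrow> real) \<Rightarrow> 'h"
  assumes "1 \<le> p" "continuous_on param_domain u" "\<And>k. continuous_on param_domain (T k)"
    and lim: "((\<lambda>A. Lp_norm p param_measure (\<lambda>y. u y - (\<Sum>k\<in>A. T k y))) \<longlongrightarrow> 0)
      (finite_subsets_at_top UNIV)"
    and e: "\<And>k y. y \<in> param_domain \<Longrightarrow> norm (T k y) \<le> e k" "e summable_on UNIV"
    and z: "z \<in> param_domain"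
  shows "((\<lambda>A. \<Sum>k\<in>A. T k z) \<longlongrightarrow> u z) (finite_subsets_at_top UNIV)"
proof (rule tendstoI)
  fix \<epsilon> :: real assume \<epsilon>: "0 < \<epsilon>"
  have e0: "0 \<le> e k" for k using e(1)[OF z, of k] norm_ge_zero order.trans by blast
  obtain A0 where A0: "finite A0" "\<And>B. finite B \<Longrightarrow> A0 \<inter> B = {} \<Longrightarrow> sum e B < \<epsilon> / 2"
    using summable_on_UNIV_real_tail[OF e(2) e0, of "\<epsilon> / 2"] \<epsilon> by auto
  have "dist (\<Sum>k\<in>A. T k z) (u z) < \<epsilon>" if A: "finite A" "A0 \<subseteq> A" for A
  proof (rule ccontr)
    define g where "g y = norm (u y - (\<Sum>k\<in>A. T k y))" for y
    assume "\<not> ?thesis"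
    \<comment> \<open>The deviation exceeds \<open>3/4\<close> of \<open>\<epsilon>\<close> on a
      neighbourhood, and terms outside \<open>A\<close> change it by less than \<open>1/2\<close> of
      \<open>\<epsilon>\<close>. A quarter of \<open>\<epsilon>\<close> is left over.\<close>
    then have "\<epsilon> * 3 / 4 < g z" using \<epsilon> by (simp add: g_def dist_norm norm_minus_commute)
    moreover have "continuous_on param_domain g"
      unfolding g_def using assms(2,3) by (intro continuous_intros)
    ultimately obtain B where B: "B \<in> sets param_measure" "0 < emeasure param_measure B"
        "B \<subseteq> param_domain" "\<And>y. y \<in> B \<Longrightarrow> \<epsilon> * 3 / 4 < g y"
      using continuous_param_neighbourhood z by metis
    obtain d where d: "0 < d" "\<And>f :: ('m \<Rightarrow> real) \<Rightarrow> 'h. (\<And>y. y \<in> B \<Longrightarrow> \<epsilon> / 4 \<le> norm (f y))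
        \<Longrightarrow> ennreal d \<le> Lp_norm p param_measure f"
      using Lp_norm_lower_bound[OF prob_space_param_measure B(1,2), of "\<epsilon> / 4" p] \<epsilon> assms(1) by auto
    have "\<forall>\<^sub>F A' in finite_subsets_at_top UNIV.
        Lp_norm p param_measure (\<lambda>y. u y - (\<Sum>k\<in>A'. T k y)) < ennreal d"
      using lim by (rule order_tendstoD) (use d(1) in simp)
    then obtain A1 where A1: "finite A1" "\<And>A'. finite A' \<Longrightarrow> A1 \<subseteq> A' \<Longrightarrow>
        Lp_norm p param_measure (\<lambda>y. u y - (\<Sum>k\<in>A'. T k y)) < ennreal d"
      by (auto simp: eventually_finite_subsets_at_top)
    \<comment> \<open>Containing \<open>A1\<close> forces the error norm below \<open>d\<close>;
      containing \<open>A\<close> keeps the deviation on \<open>B\<close>. The two conflict.\<close>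
    define A' where "A' = A \<union> A1"
    have "\<epsilon> / 4 \<le> norm (u y - (\<Sum>k\<in>A'. T k y))" if y: "y \<in> B" for y
    proof -
      have "(\<Sum>k\<in>A'. T k y) = (\<Sum>k\<in>A. T k y) + (\<Sum>k\<in>A1 - A. T k y)"
        using A(1) A1(1) unfolding A'_def by (subst sum.union_disjoint[symmetric]) (auto intro: sum.cong)
      moreover have "norm (\<Sum>k\<in>A1 - A. T k y) \<le> sum e (A1 - A)"
        using y B(3) e(1) by (intro sum_norm_le) auto
      moreover have "sum e (A1 - A) < \<epsilon> / 2" using A A1(1) by (intro A0) auto
      moreover have "g y \<le> norm (u y - ((\<Sum>k\<in>A. T k y) + (\<Sum>k\<in>A1 - A. T k y)))
          + norm (\<Sum>k\<in>A1 - A. T k y)"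
        unfolding g_def
        using norm_triangle_ineq[of "u y - ((\<Sum>k\<in>A. T k y) + (\<Sum>k\<in>A1 - A. T k y))"
            "\<Sum>k\<in>A1 - A. T k y"] by (simp add: algebra_simps)
      ultimately show ?thesis using B(4)[OF y] by simp
    qed
    then have "ennreal d \<le> Lp_norm p param_measure (\<lambda>y. u y - (\<Sum>k\<in>A'. T k y))" by (rule d(2))
    with A1(2)[of A'] A(1) A1(1) show False by (auto simp: A'_def)
  qed
  then show "\<forall>\<^sub>F A in finite_subsets_at_top UNIV. dist (\<Sum>k\<in>A. T k z) (u z) < \<epsilon>"
    using A0(1) by (auto simp: eventually_finite_subsets_at_top)
qed

section \<open>Geometric decay of the coefficients\<close>

text \<open>Square summability bounds all weighted coefficients uniformly, so
  \<open>norm (uc k)\<close> decays at least like the reciprocal of the weight. Part of this decay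
  pays for the polynomial factors, and the rest is geometric.\<close>

lemma weighted_coefficients_geometric_bound:
  fixes uc :: "('m::finite \<Rightarrow> nat) \<Rightarrow> 'h::real_normed_vector" and \<rho> :: "'m \<Rightarrow> real"
  assumes c: "0 \<le> c" "0 \<le> \<theta>" "0 \<le> d" "0 \<le> \<tau>"
    and rho: "\<And>m. \<rho> m > 1"
    and decay: "(\<lambda>k. ((\<Prod>m\<in>UNIV. \<rho> m ^ k m) * norm (uc k))\<^sup>2) summable_on UNIV"
  obtains L q :: real where "0 \<le> L" "0 < q" "q < 1"
    "\<And>k. norm (uc k) * (\<Prod>m\<in>UNIV. (1 + c * k m) powr \<theta> * (1 + d * k m) powr \<tau>)
       \<le> L * (\<Prod>m\<in>UNIV. q ^ k m)"
proof -
  define \<rho>0 where "\<rho>0 = Min (range \<rho>)"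
  have \<rho>0: "1 < \<rho>0" "\<And>m. \<rho>0 \<le> \<rho> m" using rho by (auto simp: \<rho>0_def)
  \<comment> \<open>The midpoint of \<open>1 / \<rho>0\<close> and \<open>1\<close>: it leaves
    \<open>q < 1\<close> for the decay and \<open>\<rho>0 * q > 1\<close> for absorbing the
    growth.\<close>
  define q where "q = (1 + 1 / \<rho>0) / 2"
  have q: "0 < q" "q < 1" using \<rho>0 by (auto simp: q_def field_simps)
  have b: "1 < \<rho>0 * q" using \<rho>0 by (simp add: q_def field_simps)
  obtain K where K: "0 \<le> K"
      "\<And>k :: nat. (1 + c * k) powr \<theta> * (1 + d * k) powr \<tau> \<le> K * (\<rho>0 * q) ^ k"
    using polynomial_growth_le_exponential[OF c(1,3,2,4) b] by blast
  define D where "D k = (\<Prod>m\<in>UNIV. \<rho> m ^ k m) * norm (uc k)" for k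
  define W where "W = (\<Sum>\<^sub>\<infinity>k. (D k)\<^sup>2)"
  have "(D k)\<^sup>2 \<le> W" for k
    unfolding W_def
    using finite_sum_le_infsum[of "\<lambda>k. (D k)\<^sup>2" UNIV "{k}"] decay by (simp add: D_def)
  then have D: "D k \<le> sqrt W" for k by (rule real_le_rsqrt)
  define L where "L = K ^ CARD('m) * sqrt W"
  have "norm (uc k) * (\<Prod>m\<in>UNIV. (1 + c * k m) powr \<theta> * (1 + d * k m) powr \<tau>)
       \<le> L * (\<Prod>m\<in>UNIV. q ^ k m)" for k
  proof -
    have "(\<Prod>m\<in>UNIV. (1 + c * k m) powr \<theta> * (1 + d * k m) powr \<tau>) \<le>
        (\<Prod>m\<in>UNIV. K * (\<rho> m * q) ^ k m)"
    proof (intro prod_mono conjI)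
      fix m
      have "K * (\<rho>0 * q) ^ k m \<le> K * (\<rho> m * q) ^ k m"
        using K(1) \<rho>0 q by (intro mult_left_mono power_mono mult_right_mono) auto
      with K(2)[of "k m"]
      show "(1 + c * k m) powr \<theta> * (1 + d * k m) powr \<tau> \<le> K * (\<rho> m * q) ^ k m" by linarith
    qed simp
    then have "norm (uc k) * (\<Prod>m\<in>UNIV. (1 + c * k m) powr \<theta> * (1 + d * k m) powr \<tau>) \<le>
        norm (uc k) * (\<Prod>m\<in>UNIV. K * (\<rho> m * q) ^ k m)" by (intro mult_left_mono) auto
    also have "\<dots> = K ^ CARD('m) * D k * (\<Prod>m\<in>UNIV. q ^ k m)"
      by (simp add: D_def prod.distrib power_mult_distrib)
    also have "\<dots> \<le> K ^ CARD('m) * sqrt W * (\<Prod>m\<in>UNIV. q ^ k m)"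
      using D K(1) q by (intro mult_right_mono mult_left_mono) (auto intro!: prod_nonneg)
    finally show ?thesis by (simp add: L_def)
  qed
  moreover have "0 \<le> L"
    using K(1) finite_sum_le_infsum[of "\<lambda>k. (D k)\<^sup>2" UNIV "{}"] decay by (simp add: L_def W_def D_def)
  ultimately show ?thesis using that q by blast
qed

section \<open>Summable indicators and convergence of the adaptive approximations\<close>

theorem theorem10:
  fixes node :: "nat \<Rightarrow> real"
    and mm :: "nat \<Rightarrow> nat"
    and p :: ennreal
    and u :: "('m::finite \<Rightarrow> real) \<Rightarrow> 'h::{real_inner, banach, second_countable_topology}"
    and uc :: "('m \<Rightarrow> nat) \<Rightarrow> 'h"
    and P :: "nat \<Rightarrow> real poly"
    and ct \<theta>t c \<theta> :: real
    and \<rho> :: "'m \<Rightarrow> real"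
    and C :: ennreal
    and U :: "nat \<Rightarrow> ('m \<Rightarrow> real) \<Rightarrow> 'h"
  assumes nodes: "range node \<subseteq> {-1..1}" "inj node"
    and levels: "strict_mono mm" "mm 0 = 0"
    and p: "1 \<le> p"
    and u_cont: "continuous_on param_domain u"
    and P_poly: "\<And>k. degree (P k) = k" "P 0 = 1"
    and P_bound: "0 \<le> ct" "0 \<le> \<theta>t"
      "\<And>k. sup_norm (poly (P k)) \<le> (1 + ct * real k) powr \<theta>t"
    and expansion:
      "((\<lambda>A. Lp_norm p param_measure
                (\<lambda>y. u y - (\<Sum>k\<in>A. (\<Prod>m\<in>UNIV. poly (P (k m)) (y m)) *\<^sub>R uc k)))
         \<longlongrightarrow> 0) (finite_subsets_at_top UNIV)"
    and rho: "\<And>m. \<rho> m > 1"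
    and decay: "(\<lambda>k. ((\<Prod>m\<in>UNIV. \<rho> m ^ k m) * norm (uc k))\<^sup>2) summable_on UNIV"
    and C: "C < \<infinity>"
      "\<And>\<Lambda>. finite \<Lambda> \<Longrightarrow> \<Lambda> \<noteq> {} \<Longrightarrow> monotone_index_set \<Lambda> \<Longrightarrow>
         Lp_norm p param_measure (\<lambda>y. u y - sparse_interp node mm \<Lambda> u y)
           \<le> C * (\<Sum>k\<in>reduced_margin \<Lambda>. Lp_norm p param_measure (tensor_detail node mm k u))"
    and detail_bound: "0 \<le> c" "0 \<le> \<theta>"
      "\<And>k. detail_opnorm node mm k \<le> ennreal ((1 + c * real k) powr \<theta>)"
    and run: "gerstner_griebel node mm p u U"
  shows "(\<lambda>n. Lp_norm p param_measure (\<lambda>y. u y - U n y)) \<longlonglongrightarrow> 0"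
proof -
  define T where "T k y = (\<Prod>m\<in>UNIV. poly (P (k m)) (y m)) *\<^sub>R uc k" for k y
  \<comment> \<open>The detail bound at level \<open>k\<close> times the bound for
    \<open>P k\<close>. Since the first factor is at least \<open>1\<close>, \<open>G\<close> also
    dominates \<open>P k\<close> itself.\<close>
  define G where "G k = (1 + c * real k) powr \<theta> * (1 + ct * real k) powr \<theta>t" for k :: nat
  obtain L q where L: "0 \<le> L" and q: "0 < q" "q < 1"
    and bound: "\<And>k. norm (uc k) * (\<Prod>m\<in>UNIV. (1 + c * real (k m)) powr \<theta> * (1 + ct * real (k m)) powr \<theta>t)
      \<le> L * (\<Prod>m\<in>UNIV. q ^ k m)"
    by (rule weighted_coefficients_geometric_bound[where uc = uc and \<rho> = \<rho>,
          OF detail_bound(1,2) P_bound(1,2) rho decay]) (rule that)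
  have G: "norm (uc k) * (\<Prod>m\<in>UNIV. G (k m)) \<le> L * (\<Prod>m\<in>UNIV. q ^ k m)" for k
    using bound by (simp add: G_def)
  define s where "s = sqrt q"
  have s: "0 < s" "s < 1" "q = s * s" using q by (auto simp: s_def)
  have summable_s: "(\<lambda>k :: 'm \<Rightarrow> nat. \<Prod>m\<in>UNIV. s ^ k m) summable_on UNIV"
    using s by (intro summable_on_prod_power) auto
  have P_le: "\<bar>poly (P j) t\<bar> \<le> (1 + ct * real j) powr \<theta>t" if "t \<in> {-1..1}" for j t
    using abs_le_sup_norm[of "poly (P j)" t] P_bound(3)[of j] that
    by (fastforce intro!: continuous_intros)
  have T_le: "norm (T k y) \<le> L * (\<Prod>m\<in>UNIV. q ^ k m)" if y: "y \<in> param_domain" for k y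
  proof -
    have "\<bar>poly (P (k m)) (y m)\<bar> \<le> G (k m)" for m
    proof -
      have "1 \<le> (1 + c * real (k m)) powr \<theta>"
        using detail_bound(1,2) by (intro ge_one_powr_ge_zero) auto
      then have "1 * (1 + ct * real (k m)) powr \<theta>t \<le> G (k m)"
        unfolding G_def by (intro mult_right_mono) auto
      then show ?thesis using P_le[of "y m" "k m"] y by (auto simp: param_domain_def)
    qed
    then have "(\<Prod>m\<in>UNIV. \<bar>poly (P (k m)) (y m)\<bar>) \<le> (\<Prod>m\<in>UNIV. G (k m))"
      by (intro prod_mono) auto
    then have "norm (T k y) \<le> norm (uc k) * (\<Prod>m\<in>UNIV. G (k m))"
      by (simp add: T_def abs_prod mult.commute mult_left_mono)
    with G[of k] show ?thesis by linarith
  qed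
  have detail_T_le: "norm (tensor_detail node mm i (T k) y) \<le>
      L * (\<Prod>m\<in>UNIV. s ^ i m) * (\<Prod>m\<in>UNIV. s ^ k m)" if y: "y \<in> param_domain" for i k y
  proof -
    have eq: "tensor_detail node mm i (T k) y =
        (\<Prod>m\<in>UNIV. detail node mm (i m) (poly (P (k m))) (y m)) *\<^sub>R uc k"
      unfolding T_def
      by (rule fun_cong[OF tensor_detail_product[OF nodes(2) levels(1), where h = "\<lambda>m. poly (P (k m))"]])
    show ?thesis
    proof (cases "\<exists>m. k m < i m")
      case True
      then obtain m where "k m < i m" by blast
      then have "detail node mm (i m) (poly (P (k m))) (y m) = 0"
        using nodes levels P_poly(1) by (intro detail_poly_eq_0) auto
      then have "tensor_detail node mm i (T k) y = 0"
        unfolding eq by (metis UNIV_I finite_class.finite_UNIV prod_zero_iff scaleR_zero_left)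
      then show ?thesis using L s by (auto intro!: mult_nonneg_nonneg prod_nonneg)
    next
      case False
      then have ik: "i m \<le> k m" for m by (meson not_less)
      have "\<bar>detail node mm (i m) (poly (P (k m))) (y m)\<bar> \<le> G (k m)" for m
      proof -
        have "\<bar>detail node mm (i m) (poly (P (k m))) (y m)\<bar> \<le>
            (1 + c * real (i m)) powr \<theta> * sup_norm (poly (P (k m)))"
          using y by (intro abs_detail_le[OF nodes(2) levels(1) nodes(1)] detail_bound(3))
            (auto simp: param_domain_def intro!: continuous_intros)
        \<comment> \<open>The level \<open>i m\<close> may be raised to \<open>k m\<close> because
          only terms with \<open>i m \<le> k m\<close> remain.\<close>
        also have "\<dots> \<le> (1 + c * real (k m)) powr \<theta> * (1 + ct * real (k m)) powr \<theta>t"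
        proof (intro mult_mono powr_mono2 P_bound(3))
          show "0 \<le> sup_norm (poly (P (k m)))"
            using abs_le_sup_norm[of "poly (P (k m))" 0] by (fastforce intro!: continuous_intros)
        qed (use ik detail_bound(1,2) in \<open>auto intro!: mult_left_mono\<close>)
        finally show ?thesis by (simp add: G_def)
      qed
      then have "(\<Prod>m\<in>UNIV. \<bar>detail node mm (i m) (poly (P (k m))) (y m)\<bar>) \<le> (\<Prod>m\<in>UNIV. G (k m))"
        by (intro prod_mono) auto
      then have "norm (tensor_detail node mm i (T k) y) \<le> norm (uc k) * (\<Prod>m\<in>UNIV. G (k m))"
        by (simp add: eq abs_prod mult.commute mult_left_mono)
      also note G[of k]
      \<comment> \<open>One copy of the \<open>s\<close>-product is kept for summation over
        \<open>k\<close>; the other is weakened from \<open>k\<close> to \<open>i\<close>, giving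
        decay in \<open>i\<close>.\<close>
      also have "(\<Prod>m\<in>UNIV. q ^ k m) = (\<Prod>m\<in>UNIV. s ^ k m) * (\<Prod>m\<in>UNIV. s ^ k m)"
        by (simp add: s(3) power_mult_distrib prod.distrib)
      also have "L * \<dots> \<le> L * ((\<Prod>m\<in>UNIV. s ^ i m) * (\<Prod>m\<in>UNIV. s ^ k m))"
        using L s ik
        by (intro mult_left_mono mult_right_mono prod_mono) (auto intro!: prod_nonneg power_decreasing)
      finally show ?thesis by (simp add: mult.assoc)
    qed
  qed
  have cont_T: "continuous_on S (T k)" for S k
    unfolding T_def
    by (intro continuous_on_scaleR continuous_on_prod continuous_on_poly continuous_on_const
        continuous_on_subset[OF continuous_on_product_coordinates subset_UNIV])
  have expansion_T: "((\<lambda>A. Lp_norm p param_measure (\<lambda>y. u y - (\<Sum>k\<in>A. T k y))) \<longlongrightarrow> 0)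
      (finite_subsets_at_top UNIV)"
    using expansion by (simp add: T_def)
  have pointwise: "((\<lambda>A. \<Sum>k\<in>A. T k z) \<longlongrightarrow> u z) (finite_subsets_at_top UNIV)"
    if "z \<in> param_domain" for z
  proof -
    have "(\<lambda>k :: 'm \<Rightarrow> nat. L * (\<Prod>m\<in>UNIV. q ^ k m)) summable_on UNIV"
      using q by (intro summable_on_cmult_right summable_on_prod_power) auto
    then show ?thesis
      using T_le
      by (intro pointwise_convergent_expansion[OF p u_cont cont_T expansion_T _ _ that,
            where e = "\<lambda>k. L * (\<Prod>m\<in>UNIV. q ^ k m)"])
  qed
  \<comment> \<open>Some expansion error has finite norm and is therefore measurable; adding back
    the measurable partial sum recovers \<open>u\<close>.\<close>
  have u_meas: "u \<in> borel_measurable param_measure"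
  proof -
    have "\<forall>\<^sub>F A in finite_subsets_at_top UNIV.
        Lp_norm p param_measure (\<lambda>y. u y - (\<Sum>k\<in>A. T k y)) < \<infinity>"
      by (rule order_tendstoD(2)[OF expansion_T]) simp
    then obtain A where "Lp_norm p param_measure (\<lambda>y. u y - (\<Sum>k\<in>A. T k y)) < \<infinity>"
      by (auto simp: eventually_finite_subsets_at_top)
    then have "(\<lambda>y. u y - (\<Sum>k\<in>A. T k y)) \<in> borel_measurable param_measure"
      by (auto simp: Lp_norm_def split: if_splits)
    moreover have "(\<lambda>y. \<Sum>k\<in>A. T k y) \<in> borel_measurable param_measure"
      unfolding T_def
      by (intro borel_measurable_sum borel_measurable_scaleR borel_measurable_prod
          measurable_param_poly) simp
    ultimately have "(\<lambda>y. (u y - (\<Sum>k\<in>A. T k y)) + (\<Sum>k\<in>A. T k y)) \<in> borel_measurable param_measure"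
      by (rule borel_measurable_add)
    then show ?thesis by simp
  qed
  define Z where "Z = (\<Sum>\<^sub>\<infinity>k :: 'm \<Rightarrow> nat. \<Prod>m\<in>UNIV. s ^ k m)"
  define e where "e i = L * Z * (\<Prod>m\<in>UNIV. s ^ i m)" for i :: "'m \<Rightarrow> nat"
  have e0: "0 \<le> e i" for i
    unfolding e_def Z_def using L s
    by (intro mult_nonneg_nonneg infsum_nonneg prod_nonneg) auto
  have detail_le: "norm (tensor_detail node mm i u y) \<le> e i" if y: "y \<in> param_domain" for i y
  \<comment> \<open>The bound is uniform over finite partial sums. It passes to \<open>u\<close>
    because the expansion converges at every point of the cube.\<close>
  proof (rule tendsto_upperbound)
    show "((\<lambda>A. norm (tensor_detail node mm i (\<lambda>y. \<Sum>k\<in>A. T k y) y)) \<longlongrightarrow>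
        norm (tensor_detail node mm i u y)) (finite_subsets_at_top UNIV)"
      by (intro tendsto_norm tendsto_tensor_detail[OF nodes(2) levels(1) nodes(1) _ y] pointwise)
    have "norm (tensor_detail node mm i (\<lambda>y. \<Sum>k\<in>A. T k y) y) \<le> e i" if A: "finite A" for A
    proof -
      have "norm (tensor_detail node mm i (\<lambda>y. \<Sum>k\<in>A. T k y) y) \<le>
          (\<Sum>k\<in>A. L * (\<Prod>m\<in>UNIV. s ^ i m) * (\<Prod>m\<in>UNIV. s ^ k m))"
        unfolding tensor_detail_sum[OF nodes(2) levels(1)] by (intro sum_norm_le detail_T_le y)
      also have "\<dots> = L * (\<Prod>m\<in>UNIV. s ^ i m) * (\<Sum>k\<in>A. \<Prod>m\<in>UNIV. s ^ k m)"
        by (simp add: sum_distrib_left)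
      also have "\<dots> \<le> L * (\<Prod>m\<in>UNIV. s ^ i m) * Z"
        unfolding Z_def using L s A
        by (intro mult_left_mono finite_sum_le_infsum summable_s) (auto intro!: mult_nonneg_nonneg prod_nonneg)
      finally show ?thesis by (simp add: e_def mult_ac)
    qed
    then show "\<forall>\<^sub>F A in finite_subsets_at_top UNIV.
        norm (tensor_detail node mm i (\<lambda>y. \<Sum>k\<in>A. T k y) y) \<le> e i"
      by (intro eventually_finite_subsets_at_top_weakI) auto
  qed simp
  have eta_le: "indicator_eta node mm p u i \<le> ennreal (e i)" for i
    unfolding indicator_eta_def
    by (intro Lp_norm_le_bound prob_space_param_measure e0 p detail_le
        measurable_tensor_detail[OF nodes(2) levels(1) nodes(1) u_meas]) (simp add: space_param_measure)
  obtain \<Lambda> kstar where \<Lambda>: "\<Lambda> 0 = {\<lambda>_. 0}"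
      "\<And>n. is_arg_max (indicator_eta node mm p u) (\<lambda>k. k \<in> reduced_margin (\<Lambda> n)) (kstar n)"
      "\<And>n. \<Lambda> (Suc n) = \<Lambda> n \<union> {kstar n}"
      "\<And>n. U n = sparse_interp node mm (\<Lambda> n) u"
    using run unfolding gerstner_griebel_def by (elim exE conjE) metis
  have \<Lambda>_adm: "finite (\<Lambda> n) \<and> \<Lambda> n \<noteq> {} \<and> monotone_index_set (\<Lambda> n)" for n
  proof (induction n)
    case 0
    then show ?case by (simp add: \<Lambda>(1) monotone_index_set_def)
  next
    case (Suc n)
    moreover have "kstar n \<in> reduced_margin (\<Lambda> n)" using \<Lambda>(2)[of n] by (simp add: is_arg_max_def)
    ultimately show ?case
      using monotone_index_set_insert_reduced_margin[of "\<Lambda> n" "kstar n"] by (simp add: \<Lambda>(3))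
  qed
  have "(\<lambda>n. \<Sum>k\<in>reduced_margin (\<Lambda> n). indicator_eta node mm p u k) \<longlonglongrightarrow> 0"
  proof (rule greedy_margin_sum_tendsto_0[where \<Lambda> = \<Lambda> and kstar = kstar and e = e])
    show "e summable_on UNIV"
      unfolding e_def by (intro summable_on_cmult_right summable_s)
  qed (rule \<Lambda>(2) \<Lambda>(3) eta_le e0)+
  \<comment> \<open>Finiteness of \<open>C\<close> makes multiplication by it continuous at the
    limit \<open>0\<close> in \<open>ennreal\<close>.\<close>
  then have "(\<lambda>n. C * (\<Sum>k\<in>reduced_margin (\<Lambda> n). indicator_eta node mm p u k)) \<longlonglongrightarrow> C * 0"
    using C(1) by (intro ennreal_tendsto_cmult) auto
  then have upper: "(\<lambda>n. C * (\<Sum>k\<in>reduced_margin (\<Lambda> n). indicator_eta node mm p u k)) \<longlonglongrightarrow> 0" by simp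
  show ?thesis
  proof (rule tendsto_sandwich[OF always_eventually always_eventually tendsto_const upper])
    show "\<forall>n. Lp_norm p param_measure (\<lambda>y. u y - U n y) \<le>
        C * (\<Sum>k\<in>reduced_margin (\<Lambda> n). indicator_eta node mm p u k)"
    proof
      fix n
      show "Lp_norm p param_measure (\<lambda>y. u y - U n y) \<le>
          C * (\<Sum>k\<in>reduced_margin (\<Lambda> n). indicator_eta node mm p u k)"
        unfolding \<Lambda>(4) indicator_eta_def using \<Lambda>_adm[of n] by (intro C(2)) simp_all
    qed
  qed simp
qed

end
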